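(* Let $\|\cdot\|$ be a norm on $\mathbb{R}^d$ with associated Capra coupling ¢. Suppose that both the norm $\|\cdot\|$ and its dual norm $\|\cdot\|_\star$ are orthant-strictly monotonic, and let $\varphi:\{0,1,\ldots,d\}\to\mathbb{R}$ be a nondecreasing function. Then $\partial_{¢}(\varphi\circ\ell_0)(x)\neq\emptyset$ for all $x\in\mathbb{R}^d$. More precisely: - When $x=0$, $\partial_{¢}(\varphi\circ\ell_0)(0)=\bigcap_{j\in\{1,\ldots,d\}}[\varphi(j)-\varphi(0)]\,B^{\mathrm{R}\star}_{(j)}\neq\emptyset$. - When $x\neq 0$, there exists $y\in\mathbb{R}^d$ satisfying $\mathrm{supp}(y)=\mathrm{supp}(x)$ and $\langle x,y\rangle=\|x\|\,\|y\|_\star$, and for all such $y\in\mathbb{R}^d$ we have $\lambda y\in\partial_{¢}(\varphi\circ\ell_0)(x)$ for $\lambda>0$ large enough.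
   Context: $\mathbb{R}^d$ ($d\ge1$) is equipped with the scalar product $\langle\cdot,\cdot\rangle$ (the source norm $\|\cdot\|$ need not be Euclidean). For $x\in\mathbb{R}^d$, $\mathrm{supp}(x)=\{j\in\{1,\ldots,d\}: x_j\ne0\}$ and the $\ell_0$ pseudonorm is $\ell_0(x)=|\mathrm{supp}(x)|$. The dual norm is $\|y\|_\star=\sup_{\|x\|\le1}\langle x,y\rangle$. Orthant-strictly monotonic: a norm $N$ on $\mathbb{R}^d$ is orthant-strictly monotonic if, for all $x,x'\in\mathbb{R}^d$ such that $|x_i|\le|x'_i|$ for all $i$, $|x_j|<|x'_j|$ for some $j$, and $x_ix'_i\ge0$ for all $i$, one has $N(x)<N(x')$. Capra coupling: ¢$(x,y)=\langle x,y\rangle/\|x\|$ if $x\neq0$, and ¢$(0,y)=0$. The Moreau lower addition $\dot{+}$ extends the usual addition to $\overline{\mathbb{R}}=[-\infty,+\infty]$ with $(+\infty)\dot{+}(-\infty)=(-\infty)\dot{+}(+\infty)=-\infty$. For $f:\mathbb{R}^d\to\overline{\mathbb{R}}$, $f^{¢}(y)=\sup_{x\in\mathbb{R}^d}(¢(x,y)\dot{+}(-f(x)))$, and the Capra-subdifferential at $x$ is $\partial_{¢}f(x)=\{y\in\mathbb{R}^d: f^{¢}(y)=¢(x,y)\dot{+}(-f(x))\}$. Generalized dual coordinate-$k$ norm: for $K\subset\{1,\ldots,d\}$, let $\mathcal{R}_K=\{x\in\mathbb{R}^d: x_j=0\ \forall j\notin K\}$, and let $y_K\in\mathcal{R}_K$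 be the vector coinciding with $y$ on $K$ and vanishing outside $K$. Let $\|\cdot\|_{K,\star}$ be the norm on $\mathcal{R}_K$ dual to the restriction of $\|\cdot\|$ to $\mathcal{R}_K$, i.e. $\|y\|_{K,\star}=\sup\{\langle x,y\rangle: x\in\mathcal{R}_K,\ \|x\|\le1\}$ for $y\in\mathcal{R}_K$. For $k\in\{1,\ldots,d\}$, $\|y\|^{\mathrm{R}\star}_{(k)}=\sup_{|K|\le k}\|y_K\|_{K,\star}$, with closed unit ball $B^{\mathrm{R}\star}_{(k)}=\{y\in\mathbb{R}^d:\|y\|^{\mathrm{R}\star}_{(k)}\le1\}$. For $t\ge 0$, $tB=\{ty:y\in B\}$. *)

theory Defs
  imports "HOL-Analysis.Analysis"
begin

definition is_norm :: "(real ^ 'n \<Rightarrow> real) \<Rightarrow> bool" where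
  "is_norm N \<longleftrightarrow>
     (\<forall>x. N x \<ge> 0) \<and>
     (\<forall>x. N x = 0 \<longleftrightarrow> x = 0) \<and>
     (\<forall>c x. N (c *\<^sub>R x) = \<bar>c\<bar> * N x) \<and>
     (\<forall>x y. N (x + y) \<le> N x + N y)"

definition dual_norm :: "(real ^ 'n \<Rightarrow> real) \<Rightarrow> real ^ 'n \<Rightarrow> real" where
  "dual_norm N y = (SUP x\<in>{x. N x \<le> 1}. x \<bullet> y)"

definition orthant_strictly_monotonic :: "(real ^ 'n \<Rightarrow> real) \<Rightarrow> bool" where
  "orthant_strictly_monotonic N \<longleftrightarrow>
     (\<forall>x x'. (\<forall>i. \<bar>x $ i\<bar> \<le> \<bar>x' $ i\<bar>) \<and> (\<exists>j. \<bar>x $ j\<bar> < \<bar>x' $ j\<bar>) \<and> (\<forall>i. x $ i * x' $ i \<ge> 0)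
        \<longrightarrow> N x < N x')"

definition supp :: "real ^ 'n \<Rightarrow> 'n set" where
  "supp x = {j. x $ j \<noteq> 0}"

definition l0 :: "real ^ 'n \<Rightarrow> nat" where
  "l0 x = card (supp x)"

(* On ereal, the library's + has \<infinity> + (-\<infinity>) = \<infinity>; the Moreau lower addition differs exactly there. *)
definition lower_add :: "ereal \<Rightarrow> ereal \<Rightarrow> ereal"  (infixl "+\<^sub>L" 65) where
  "a +\<^sub>L b = (if a = -\<infinity> \<or> b = -\<infinity> then -\<infinity> else a + b)"

definition capra :: "(real ^ 'n \<Rightarrow> real) \<Rightarrow> real ^ 'n \<Rightarrow> real ^ 'n \<Rightarrow> real" where
  "capra N x y = (if x = 0 then 0 else (x \<bullet> y) / N x)"

definition capra_conjugate ::
    "(real ^ 'n \<Rightarrow> real) \<Rightarrow> (real ^ 'n \<Rightarrow> ereal) \<Rightarrow> real ^ 'n \<Rightarrow> ereal" where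
  "capra_conjugate N f y = (SUP x. ereal (capra N x y) +\<^sub>L (- f x))"

definition capra_subdifferential ::
    "(real ^ 'n \<Rightarrow> real) \<Rightarrow> (real ^ 'n \<Rightarrow> ereal) \<Rightarrow> real ^ 'n \<Rightarrow> (real ^ 'n) set" where
  "capra_subdifferential N f x =
     {y. capra_conjugate N f y = ereal (capra N x y) +\<^sub>L (- f x)}"

definition coord_subspace :: "'n set \<Rightarrow> (real ^ 'n) set" where
  "coord_subspace K = {x. \<forall>j. j \<notin> K \<longrightarrow> x $ j = 0}"

definition coord_proj :: "'n set \<Rightarrow> real ^ 'n \<Rightarrow> real ^ 'n" where
  "coord_proj K y = (\<chi> j. if j \<in> K then y $ j else 0)"

definition restricted_dual_norm ::
    "(real ^ 'n \<Rightarrow> real) \<Rightarrow> 'n set \<Rightarrow> real ^ 'n \<Rightarrow> real" where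
  "restricted_dual_norm N K y = (SUP x\<in>{x \<in> coord_subspace K. N x \<le> 1}. x \<bullet> y)"

definition dual_coord_norm :: "(real ^ 'n \<Rightarrow> real) \<Rightarrow> nat \<Rightarrow> real ^ 'n \<Rightarrow> real" where
  "dual_coord_norm N k y = (SUP K\<in>{K. card K \<le> k}. restricted_dual_norm N K (coord_proj K y))"

definition dual_coord_ball :: "(real ^ 'n \<Rightarrow> real) \<Rightarrow> nat \<Rightarrow> (real ^ 'n) set" where
  "dual_coord_ball N k = {y. dual_coord_norm N k y \<le> 1}"

end

theory Submission
  imports Defs
begin

text \<open>
  For a finite-valued function \<open>f\<close>, a vector \<open>y\<close> is a Capra-subgradient at \<open>x\<close> exactly when \<open>x\<close>
  maximises \<open>\<lambda>z. capra N z y - f z\<close>. Everything below is a reading of this family of inequalities.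

  At the origin it says \<open>z \<bullet> y \<le> (\<phi> (l0 z) - \<phi> 0) * N z\<close> for all \<open>z\<close>. The generalized dual
  coordinate-\<open>k\<close> norm is the gauge that tests \<open>y\<close> against all vectors with at most \<open>k\<close> nonzero
  entries (lemma \<open>dual_coord_norm_le_iff\<close>), so grouping the inequalities by the sparsity of \<open>z\<close> and
  using the monotonicity of \<open>\<phi>\<close> gives the intersection of the scaled balls; it contains \<open>0\<close>.

  At \<open>x \<noteq> 0\<close>, separating \<open>x\<close> from the open ball of radius \<open>N x\<close> gives a dual vector \<open>y\<close>. Since
  deleting an entry of \<open>x\<close> strictly lowers \<open>N\<close>, every \<open>x $ i * y $ i\<close> with \<open>i \<in> supp x\<close> is positive,
  and since deleting entries of \<open>y\<close> does not raise the dual norm, the entries outside \<open>supp x\<close>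
  can be dropped (lemma \<open>ex_dual_vector_same_supp\<close>).
  Given such a \<open>y\<close>, the map \<open>z \<mapsto> capra N z y\<close> is bounded by \<open>dual_norm N y\<close>, a bound attained at \<open>x\<close>.
  A competitor \<open>z\<close> with \<open>l0 z \<ge> l0 x\<close> pays at least the penalty \<open>\<phi> (l0 x)\<close>, so it never beats \<open>x\<close>.
  A competitor with \<open>l0 z < l0 x\<close> must vanish at some \<open>j \<in> supp y\<close>, so it only sees \<open>y\<close> with entry
  \<open>j\<close> deleted, whose dual norm is strictly smaller. This gap takes finitely many values, one for
  each \<open>j\<close>; multiplying \<open>y\<close> by a large \<open>t\<close> makes each of them at least \<open>\<phi> (l0 x) - \<phi> 0\<close>, which is
  the most that \<open>z\<close> can save on the penalty.
\<close>

section \<open>Norms on coordinate space and their duals\<close>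

lemma is_normD:
  assumes "is_norm N"
  shows "0 \<le> N x" and "N x = 0 \<longleftrightarrow> x = 0" and "N (c *\<^sub>R x) = \<bar>c\<bar> * N x" and "N (x + y) \<le> N x + N y"
  using assms by (auto simp: is_norm_def)

lemma is_norm_pos:
  assumes "is_norm N" and "x \<noteq> 0"
  shows "0 < N x"
  using is_normD(1,2)[OF assms(1)] assms(2) by (metis less_eq_real_def)

lemma is_norm_convex_on:
  fixes N :: "real ^ 'n \<Rightarrow> real"
  assumes "is_norm N"
  shows "convex_on UNIV N"
proof (rule convex_onI)
  fix t :: real and x y :: "real ^ 'n"
  assume "0 < t" "t < 1"
  then show "N ((1 - t) *\<^sub>R x + t *\<^sub>R y) \<le> (1 - t) * N x + t * N y"
    using is_normD(4)[OF assms, of "(1 - t) *\<^sub>R x" "t *\<^sub>R y"] by (simp add: is_normD(3)[OF assms])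
qed simp

text \<open>
  Being convex, \<open>N\<close> is continuous, hence attains a positive minimum on the Euclidean unit sphere.
  This makes the unit ball of \<open>N\<close> bounded, so that the suprema defining the dual norms are finite.
\<close>
lemma is_norm_dominates_euclidean:
  fixes N :: "real ^ 'n \<Rightarrow> real"
  assumes "is_norm N"
  obtains c where "0 < c" and "\<And>x. norm x \<le> c * N x"
proof -
  have "continuous_on (sphere 0 1) N"
    using convex_on_continuous[OF open_UNIV is_norm_convex_on[OF assms]] continuous_on_subset by blast
  moreover have "sphere (0 :: real ^ 'n) 1 \<noteq> {}" by simp
  ultimately obtain u where u: "u \<in> sphere 0 1" "\<And>v. v \<in> sphere 0 1 \<Longrightarrow> N u \<le> N v"
    using continuous_attains_inf[OF compact_sphere] by metis
  have pos: "0 < N u" using u(1) by (intro is_norm_pos[OF assms]) auto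
  have "norm x \<le> inverse (N u) * N x" for x
  proof (cases "x = 0")
    case True
    then show ?thesis using is_normD(1)[OF assms] pos by simp
  next
    case False
    then have "N u \<le> N ((1 / norm x) *\<^sub>R x)" by (intro u(2)) simp
    also have "\<dots> = N x / norm x" by (simp add: is_normD(3)[OF assms])
    finally show ?thesis using pos False by (simp add: field_simps)
  qed
  with pos show ?thesis by (intro that[of "inverse (N u)"]) auto
qed

lemma bdd_above_inner_unit_ball:
  fixes N :: "real ^ 'n \<Rightarrow> real"
  assumes "is_norm N"
  shows "bdd_above ((\<lambda>x. x \<bullet> y) ` {x \<in> S. N x \<le> 1})"
proof -
  obtain c where c: "0 < c" "\<And>x. norm x \<le> c * N x"
    using is_norm_dominates_euclidean[OF assms] by metis
  have "x \<bullet> y \<le> c * norm y" if "N x \<le> 1" for x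
  proof -
    have "norm x \<le> c" using c(2)[of x] mult_left_mono[OF that less_imp_le[OF c(1)]] by simp
    then show ?thesis by (meson norm_cauchy_schwarz mult_right_mono norm_ge_zero order_trans)
  qed
  then show ?thesis by (intro bdd_aboveI[of _ "c * norm y"]) auto
qed

text \<open>
  The restricted dual norm is the best constant in the Hoelder inequality on \<open>coord_subspace K\<close>.
  Negative \<open>c\<close> are excluded because of \<open>K = {}\<close>, where the right-hand side holds for every \<open>c\<close> while
  the supremum is \<open>0\<close>.
\<close>
lemma restricted_dual_norm_le_iff:
  assumes "is_norm N" and "0 \<le> c"
  shows "restricted_dual_norm N K y \<le> c \<longleftrightarrow> (\<forall>x\<in>coord_subspace K. x \<bullet> y \<le> c * N x)"
proof -
  have ne: "{x \<in> coord_subspace K. N x \<le> 1} \<noteq> {}"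
    using is_normD(2)[OF assms(1), of 0] by (auto simp: coord_subspace_def intro!: exI[of _ 0])
  have "restricted_dual_norm N K y \<le> c
      \<longleftrightarrow> (\<forall>x\<in>{x \<in> coord_subspace K. N x \<le> 1}. x \<bullet> y \<le> c)"
    unfolding restricted_dual_norm_def by (rule cSUP_le_iff[OF ne bdd_above_inner_unit_ball[OF assms(1)]])
  also have "\<dots> \<longleftrightarrow> (\<forall>x\<in>coord_subspace K. x \<bullet> y \<le> c * N x)"
  proof (intro iffI ballI)
    fix x assume *: "\<forall>x\<in>{x \<in> coord_subspace K. N x \<le> 1}. x \<bullet> y \<le> c" and x: "x \<in> coord_subspace K"
    show "x \<bullet> y \<le> c * N x"
    proof (cases "x = 0")
      case True
      then show ?thesis using is_normD(1)[OF assms(1)] assms(2) by simp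
    next
      case False
      then have pos: "0 < N x" by (rule is_norm_pos[OF assms(1)])
      have "((1 / N x) *\<^sub>R x) \<bullet> y \<le> c"
        using x pos by (intro *[rule_format]) (auto simp: coord_subspace_def is_normD(3)[OF assms(1)])
      then show ?thesis using pos by (simp add: field_simps)
    qed
  next
    fix x assume *: "\<forall>x\<in>coord_subspace K. x \<bullet> y \<le> c * N x" and "x \<in> {x \<in> coord_subspace K. N x \<le> 1}"
    then have "x \<bullet> y \<le> c * N x" "c * N x \<le> c" using assms(2) by (auto intro: mult_left_le)
    then show "x \<bullet> y \<le> c" by simp
  qed
  finally show ?thesis .
qed

lemma dual_norm_le_iff:
  assumes "is_norm N" and "0 \<le> c"
  shows "dual_norm N y \<le> c \<longleftrightarrow> (\<forall>x. x \<bullet> y \<le> c * N x)"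
proof -
  have "dual_norm N y = restricted_dual_norm N UNIV y"
    by (simp add: dual_norm_def restricted_dual_norm_def coord_subspace_def)
  then show ?thesis
    using restricted_dual_norm_le_iff[OF assms, of UNIV y] by (simp add: coord_subspace_def)
qed

lemma dual_norm_nonneg:
  assumes "is_norm N"
  shows "0 \<le> dual_norm N y"
proof -
  have "(0 :: real ^ 'a) \<bullet> y \<le> dual_norm N y"
    unfolding dual_norm_def using bdd_above_inner_unit_ball[OF assms, of y UNIV]
    by (intro cSUP_upper) (auto simp: is_normD(2)[OF assms, THEN iffD2])
  then show ?thesis by simp
qed

lemma inner_le_dual_norm:
  assumes "is_norm N"
  shows "x \<bullet> y \<le> dual_norm N y * N x"
  using dual_norm_le_iff[OF assms dual_norm_nonneg[OF assms]] by blast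

text \<open>
  Hahn--Banach in the form needed here: a hyperplane separating \<open>x\<close> from the convex set of points
  of smaller norm supports the closed ball through \<open>x\<close>.
\<close>
lemma ex_dual_vector:
  fixes N :: "real ^ 'n \<Rightarrow> real"
  assumes "is_norm N" and "x \<noteq> 0"
  obtains y where "y \<noteq> 0" and "x \<bullet> y = N x * dual_norm N y"
proof -
  let ?S = "{z. N z < N x}"
  have pos: "0 < N x" using assms by (rule is_norm_pos)
  have "convex ?S"
  proof (rule convexI)
    fix u v :: "real ^ 'n" and s t :: real
    assume "u \<in> ?S" "v \<in> ?S" "0 \<le> s" "0 \<le> t" "s + t = 1"
    then have "N (s *\<^sub>R u + t *\<^sub>R v) \<le> s * N u + t * N v" "s * N u + t * N v < N x"
      using is_norm_convex_on[OF assms(1)] by (auto simp: convex_on_def intro: convex_bound_lt)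
    then show "s *\<^sub>R u + t *\<^sub>R v \<in> ?S" by simp
  qed
  moreover have "0 \<in> ?S" using pos is_normD(2)[OF assms(1), of 0] by simp
  ultimately obtain y b where y: "y \<noteq> 0" "\<forall>z\<in>?S. y \<bullet> z \<le> b" "\<forall>z\<in>{x}. b \<le> y \<bullet> z"
    using separating_hyperplane_sets[of ?S "{x}"] by auto
  have small: "z \<bullet> y \<le> x \<bullet> y" if "N z < N x" for z
    using y that by (fastforce simp: inner_commute)
  have xy: "0 \<le> x \<bullet> y" using small[of 0] \<open>0 \<in> ?S\<close> by simp
  have "dual_norm N y \<le> x \<bullet> y / N x"
  proof (subst dual_norm_le_iff[OF assms(1)])
    show "0 \<le> x \<bullet> y / N x" using xy pos by simp
    show "\<forall>z. z \<bullet> y \<le> x \<bullet> y / N x * N z"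
    proof
      fix z
      show "z \<bullet> y \<le> x \<bullet> y / N x * N z"
      proof (cases "z = 0")
        case True
        then show ?thesis using xy pos is_normD(1)[OF assms(1)] by simp
      next
        case False
        then have z: "0 < N z" by (rule is_norm_pos[OF assms(1)])
        let ?w = "(N x / N z) *\<^sub>R z"
        \<comment> \<open>\<open>?w\<close> has the norm of \<open>x\<close>, so only its strict contractions lie in the separated set.\<close>
        have "s * (?w \<bullet> y) \<le> x \<bullet> y" if "0 < s" "s < 1" for s
          using small[of "s *\<^sub>R ?w"] that pos z by (simp add: is_normD(3)[OF assms(1)])
        then have "?w \<bullet> y \<le> x \<bullet> y" by (rule field_le_mult_one_interval)
        then show ?thesis using pos z by (simp add: field_simps)
      qed
    qed
  qed
  then have "x \<bullet> y = N x * dual_norm N y"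
    using pos inner_le_dual_norm[OF assms(1), of x y] by (simp add: field_simps)
  with y(1) show ?thesis by (rule that)
qed

section \<open>Deleting coordinates\<close>

lemma coord_proj_nth [simp]: "coord_proj K y $ j = (if j \<in> K then y $ j else 0)"
  by (simp add: coord_proj_def)

lemma inner_coord_proj:
  assumes "supp x \<inter> supp y \<subseteq> K"
  shows "x \<bullet> coord_proj K y = x \<bullet> y"
  unfolding inner_vec_def
proof (rule sum.cong)
  fix i
  show "x $ i \<bullet> coord_proj K y $ i = x $ i \<bullet> y $ i"
    using assms by (cases "i \<in> K") (auto simp: supp_def)
qed simp

lemma coord_proj_less:
  assumes "orthant_strictly_monotonic N" and "j \<in> supp y" and "j \<notin> K"
  shows "N (coord_proj K y) < N y"
proof -
  have "(\<forall>i. \<bar>coord_proj K y $ i\<bar> \<le> \<bar>y $ i\<bar>) \<and> (\<exists>i. \<bar>coord_proj K y $ i\<bar> < \<bar>y $ i\<bar>)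
      \<and> (\<forall>i. coord_proj K y $ i * y $ i \<ge> 0)"
    using assms(2,3) by (auto simp: supp_def intro!: exI[of _ j])
  then show ?thesis using assms(1) unfolding orthant_strictly_monotonic_def by blast
qed

lemma coord_proj_le:
  assumes "orthant_strictly_monotonic N"
  shows "N (coord_proj K y) \<le> N y"
proof (cases "supp y \<subseteq> K")
  case True
  then have "coord_proj K y = y" by (auto simp: vec_eq_iff supp_def)
  then show ?thesis by simp
next
  case False
  then show ?thesis using coord_proj_less[OF assms] by (metis less_imp_le subsetI)
qed

text \<open>
  If \<open>x $ j * y $ j \<le> 0\<close> for some \<open>j\<close> in the support of \<open>x\<close>, deleting the entry \<open>j\<close> of \<open>x\<close> would strictly
  lower its norm without lowering its product with \<open>y\<close>, against the optimality of \<open>x\<close>. Hence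
  \<open>supp x \<subseteq> supp y\<close>, and projecting \<open>y\<close> onto the coordinates in \<open>supp x\<close> keeps the pair dual.
\<close>
lemma ex_dual_vector_same_supp:
  fixes N :: "real ^ 'n \<Rightarrow> real"
  assumes N: "is_norm N" and "orthant_strictly_monotonic N"
    and "orthant_strictly_monotonic (dual_norm N)" and "x \<noteq> 0"
  obtains y where "supp y = supp x" and "x \<bullet> y = N x * dual_norm N y"
proof -
  obtain y where y: "y \<noteq> 0" "x \<bullet> y = N x * dual_norm N y"
    using ex_dual_vector[OF N \<open>x \<noteq> 0\<close>] .
  have "dual_norm N y \<noteq> 0"
  proof
    assume "dual_norm N y = 0"
    then have "y \<bullet> y \<le> 0" using inner_le_dual_norm[OF N, of y y] by simp
    with y(1) show False using inner_gt_zero_iff[of y] by linarith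
  qed
  then have dpos: "0 < dual_norm N y" using dual_norm_nonneg[OF N, of y] by simp
  have sub: "supp x \<subseteq> supp y"
  proof
    fix j assume j: "j \<in> supp x"
    let ?x = "coord_proj (- {j}) x"
    show "j \<in> supp y"
    proof (rule ccontr)
      assume "j \<notin> supp y"
      then have "y \<bullet> ?x = y \<bullet> x" by (intro inner_coord_proj) auto
      then have "dual_norm N y * N x \<le> dual_norm N y * N ?x"
        using inner_le_dual_norm[OF N, of ?x y] y(2) by (simp add: inner_commute mult.commute)
      moreover have "N ?x < N x" using coord_proj_less[OF assms(2) j] by simp
      ultimately show False using dpos by simp
    qed
  qed
  let ?y = "coord_proj (supp x) y"
  have xy: "x \<bullet> ?y = x \<bullet> y" by (intro inner_coord_proj) auto
  have "dual_norm N y * N x \<le> dual_norm N ?y * N x"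
    using inner_le_dual_norm[OF N, of x ?y] y(2) xy by (simp add: mult.commute)
  then have "dual_norm N ?y = dual_norm N y"
    using coord_proj_le[OF assms(3), of "supp x" y] is_norm_pos[OF N \<open>x \<noteq> 0\<close>] by simp
  moreover have "supp ?y = supp x" using sub by (auto simp: supp_def)
  ultimately show ?thesis using that[of ?y] xy y(2) by simp
qed

section \<open>Generalized dual coordinate norms\<close>

lemma l0_le_CARD: "l0 (x :: real ^ 'n) \<le> CARD('n)"
  unfolding l0_def by (intro card_mono) auto

lemma l0_eq_0_iff: "l0 x = 0 \<longleftrightarrow> x = 0"
  by (auto simp: l0_def supp_def vec_eq_iff)

lemma l0_0 [simp]: "l0 0 = 0"
  by (simp add: l0_eq_0_iff)

text \<open>
  The union of the subspaces \<open>coord_subspace K\<close> with \<open>card K \<le> k\<close> is the set of \<open>k\<close>-sparse vectors, and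
  on \<open>coord_subspace K\<close> pairing with \<open>y\<close> and with its projection is the same.
\<close>
lemma dual_coord_norm_le_iff:
  fixes N :: "real ^ 'n \<Rightarrow> real"
  assumes "is_norm N" and "0 \<le> c"
  shows "dual_coord_norm N k y \<le> c \<longleftrightarrow> (\<forall>x. l0 x \<le> k \<longrightarrow> x \<bullet> y \<le> c * N x)"
proof -
  have inner: "x \<bullet> coord_proj K y = x \<bullet> y" if "x \<in> coord_subspace K" for x and K :: "'n set"
    using that by (intro inner_coord_proj) (auto simp: coord_subspace_def supp_def)
  have "dual_coord_norm N k y \<le> c
      \<longleftrightarrow> (\<forall>K\<in>{K. card K \<le> k}. restricted_dual_norm N K (coord_proj K y) \<le> c)"
    unfolding dual_coord_norm_def
    by (intro cSUP_le_iff bdd_above_finite finite_imageI) (auto intro: exI[of _ "{}"])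
  also have "\<dots> \<longleftrightarrow> (\<forall>K\<in>{K. card K \<le> k}. \<forall>x\<in>coord_subspace K. x \<bullet> y \<le> c * N x)"
    by (simp add: restricted_dual_norm_le_iff[OF assms] inner)
  also have "\<dots> \<longleftrightarrow> (\<forall>x. l0 x \<le> k \<longrightarrow> x \<bullet> y \<le> c * N x)"
  proof (intro iffI allI impI ballI)
    fix x :: "real ^ 'n"
    assume "\<forall>K\<in>{K. card K \<le> k}. \<forall>x\<in>coord_subspace K. x \<bullet> y \<le> c * N x" and "l0 x \<le> k"
    moreover have "x \<in> coord_subspace (supp x)" by (simp add: coord_subspace_def supp_def)
    ultimately show "x \<bullet> y \<le> c * N x" by (auto simp: l0_def)
  next
    fix K :: "'n set" and x :: "real ^ 'n"
    assume *: "\<forall>x. l0 x \<le> k \<longrightarrow> x \<bullet> y \<le> c * N x" and "K \<in> {K. card K \<le> k}" "x \<in> coord_subspace K"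
    then have "supp x \<subseteq> K" "card K \<le> k" by (auto simp: coord_subspace_def supp_def)
    then have "l0 x \<le> k" unfolding l0_def by (meson card_mono finite_code order_trans)
    with * show "x \<bullet> y \<le> c * N x" by blast
  qed
  finally show ?thesis .
qed

text \<open>
  For \<open>c = 0\<close> the scaled ball is \<open>{0}\<close>; the equivalence survives because testing \<open>y\<close> against the
  \<open>1\<close>-sparse vectors \<open>axis i (y $ i)\<close> already forces \<open>y = 0\<close>.
\<close>
lemma mem_scaled_dual_coord_ball_iff:
  fixes N :: "real ^ 'n \<Rightarrow> real"
  assumes N: "is_norm N" and "0 \<le> c" and "1 \<le> k"
  shows "y \<in> (\<lambda>y. c *\<^sub>R y) ` dual_coord_ball N k \<longleftrightarrow> (\<forall>x. l0 x \<le> k \<longrightarrow> x \<bullet> y \<le> c * N x)"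
proof (cases "c = 0")
  case True
  have "0 \<in> dual_coord_ball N k"
    by (simp add: dual_coord_ball_def dual_coord_norm_le_iff[OF N] is_normD(1)[OF N])
  then have "(\<lambda>y. c *\<^sub>R y) ` dual_coord_ball N k = {0}" using True by auto
  moreover have "y = 0" if "\<forall>x. l0 x \<le> k \<longrightarrow> x \<bullet> y \<le> c * N x"
  proof -
    have "y $ i = 0" for i
    proof -
      let ?x = "axis i (y $ i)"
      have "l0 ?x \<le> card {i}" unfolding l0_def by (intro card_mono) (auto simp: supp_def axis_def)
      then have "?x \<bullet> y \<le> 0" using that \<open>1 \<le> k\<close> True by (metis One_nat_def card_1_singleton_iff mult_zero_left order_trans)
      then show ?thesis by (auto simp: inner_axis' mult_le_0_iff)
    qed
    then show ?thesis by (simp add: vec_eq_iff)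
  qed
  ultimately show ?thesis using True by auto
next
  case False
  then have c: "0 < c" using assms(2) by simp
  have "y \<in> (\<lambda>y. c *\<^sub>R y) ` dual_coord_ball N k \<longleftrightarrow> (1 / c) *\<^sub>R y \<in> dual_coord_ball N k"
    using c by (auto simp: image_iff intro!: bexI[of _ "(1 / c) *\<^sub>R y"])
  also have "\<dots> \<longleftrightarrow> (\<forall>x. l0 x \<le> k \<longrightarrow> x \<bullet> y \<le> c * N x)"
    using c by (simp add: dual_coord_ball_def dual_coord_norm_le_iff[OF N] field_simps)
  finally show ?thesis .
qed

section \<open>Capra-subgradients\<close>

lemma capra_subdifferential_iff:
  "y \<in> capra_subdifferential N (\<lambda>z. ereal (f z)) x \<longleftrightarrow>
    (\<forall>z. capra N z y - f z \<le> capra N x y - f x)"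
proof -
  have "y \<in> capra_subdifferential N (\<lambda>z. ereal (f z)) x \<longleftrightarrow>
      (SUP z. ereal (capra N z y - f z)) = ereal (capra N x y - f x)"
    by (simp add: capra_subdifferential_def capra_conjugate_def lower_add_def)
  also have "\<dots> \<longleftrightarrow> (SUP z. ereal (capra N z y - f z)) \<le> ereal (capra N x y - f x)"
    by (intro iffI antisym SUP_upper) auto
  also have "\<dots> \<longleftrightarrow> (\<forall>z. capra N z y - f z \<le> capra N x y - f x)"
    by (simp add: SUP_le_iff)
  finally show ?thesis .
qed

text \<open>
  The right-hand side repeats the constraint of a vector \<open>z\<close> for every \<open>j \<ge> l0 z\<close>; since \<open>\<phi>\<close> is
  nondecreasing, the one with \<open>j = l0 z\<close> implies the others.
\<close>
lemma capra_subdifferential_l0_at_0: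
  fixes N :: "real ^ 'n \<Rightarrow> real"
  assumes N: "is_norm N" and mono: "mono_on {0..CARD('n)} \<phi>"
  shows "capra_subdifferential N (\<lambda>z. ereal (\<phi> (l0 z))) 0 =
    (\<Inter>j\<in>{1..CARD('n)}. (\<lambda>y. (\<phi> j - \<phi> 0) *\<^sub>R y) ` dual_coord_ball N j)"
proof (rule set_eqI)
  fix y :: "real ^ 'n"
  have mono': "\<phi> i \<le> \<phi> j" if "i \<le> j" "j \<le> CARD('n)" for i j
    using mono_onD[OF mono, of i j] that by simp
  have "y \<in> capra_subdifferential N (\<lambda>z. ereal (\<phi> (l0 z))) 0 \<longleftrightarrow>
      (\<forall>z. z \<noteq> 0 \<longrightarrow> z \<bullet> y \<le> (\<phi> (l0 z) - \<phi> 0) * N z)"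
  proof -
    have "capra N z y - \<phi> (l0 z) \<le> - \<phi> 0 \<longleftrightarrow> (z \<noteq> 0 \<longrightarrow> z \<bullet> y \<le> (\<phi> (l0 z) - \<phi> 0) * N z)" for z
      using is_norm_pos[OF N, of z] by (auto simp: capra_def field_simps)
    then show ?thesis by (simp add: capra_subdifferential_iff capra_def[of N 0])
  qed
  also have "\<dots> \<longleftrightarrow> (\<forall>j\<in>{1..CARD('n)}. \<forall>z. l0 z \<le> j \<longrightarrow> z \<bullet> y \<le> (\<phi> j - \<phi> 0) * N z)"
  proof (intro iffI ballI allI impI)
    fix j and z :: "real ^ 'n"
    assume *: "\<forall>z. z \<noteq> 0 \<longrightarrow> z \<bullet> y \<le> (\<phi> (l0 z) - \<phi> 0) * N z" and "j \<in> {1..CARD('n)}" "l0 z \<le> j"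
    then have "(\<phi> (l0 z) - \<phi> 0) * N z \<le> (\<phi> j - \<phi> 0) * N z"
      using is_normD(1)[OF N, of z] mono'[of "l0 z" j] by (intro mult_right_mono) auto
    with * show "z \<bullet> y \<le> (\<phi> j - \<phi> 0) * N z"
      using is_normD(2)[OF N, of 0] by (cases "z = 0") auto
  next
    fix z :: "real ^ 'n"
    assume *: "\<forall>j\<in>{1..CARD('n)}. \<forall>z. l0 z \<le> j \<longrightarrow> z \<bullet> y \<le> (\<phi> j - \<phi> 0) * N z" and "z \<noteq> 0"
    then have "l0 z \<in> {1..CARD('n)}" using l0_le_CARD[of z] l0_eq_0_iff[of z] by (simp add: Suc_le_eq)
    with * show "z \<bullet> y \<le> (\<phi> (l0 z) - \<phi> 0) * N z" by blast
  qed
  also have "\<dots> \<longleftrightarrow> y \<in> (\<Inter>j\<in>{1..CARD('n)}. (\<lambda>y. (\<phi> j - \<phi> 0) *\<^sub>R y) ` dual_coord_ball N j)"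
  proof -
    have "y \<in> (\<lambda>y. (\<phi> j - \<phi> 0) *\<^sub>R y) ` dual_coord_ball N j \<longleftrightarrow>
        (\<forall>z. l0 z \<le> j \<longrightarrow> z \<bullet> y \<le> (\<phi> j - \<phi> 0) * N z)" if "j \<in> {1..CARD('n)}" for j
      using that mono'[of 0 j] by (intro mem_scaled_dual_coord_ball_iff[OF N]) auto
    then show ?thesis by (simp only: INT_iff cong: ball_cong)
  qed
  finally show "y \<in> capra_subdifferential N (\<lambda>z. ereal (\<phi> (l0 z))) 0 \<longleftrightarrow>
    y \<in> (\<Inter>j\<in>{1..CARD('n)}. (\<lambda>y. (\<phi> j - \<phi> 0) *\<^sub>R y) ` dual_coord_ball N j)" .
qed

lemma capra_le_dual_norm:
  assumes "is_norm N"
  shows "capra N z y \<le> dual_norm N y"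
  using inner_le_dual_norm[OF assms, of z y] dual_norm_nonneg[OF assms, of y] is_norm_pos[OF assms, of z]
  by (auto simp: capra_def field_simps)

text \<open>
  This is where strict monotonicity of the dual norm enters: a vector that is sparser than \<open>y\<close> misses
  some \<open>j \<in> supp y\<close>, and each of the finitely many gaps
  \<open>dual_norm N y - dual_norm N (coord_proj (- {j}) y)\<close> is positive.
\<close>
lemma eventually_scaled_dual_vector_in_subdifferential:
  fixes N :: "real ^ 'n \<Rightarrow> real"
  assumes N: "is_norm N" and osm: "orthant_strictly_monotonic (dual_norm N)"
    and mono: "mono_on {0..CARD('n)} \<phi>" and "x \<noteq> 0"
    and supp: "supp y = supp x" and xy: "x \<bullet> y = N x * dual_norm N y"
  shows "\<forall>\<^sub>F t in at_top. t *\<^sub>R y \<in> capra_subdifferential N (\<lambda>z. ereal (\<phi> (l0 z))) x"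
proof -
  let ?gap = "\<lambda>j. dual_norm N y - dual_norm N (coord_proj (- {j}) y)"
  have mono': "\<phi> i \<le> \<phi> j" if "i \<le> j" "j \<le> CARD('n)" for i j
    using mono_onD[OF mono, of i j] that by simp
  have "\<forall>\<^sub>F t in at_top. \<phi> (l0 x) - \<phi> 0 \<le> t * ?gap j" if "j \<in> supp y" for j
  proof -
    have gap: "0 < ?gap j" using coord_proj_less[OF osm that] by simp
    show ?thesis
      using eventually_ge_at_top[of "(\<phi> (l0 x) - \<phi> 0) / ?gap j"]
      by eventually_elim (use gap in \<open>simp add: pos_divide_le_eq\<close>)
  qed
  then have "\<forall>\<^sub>F t in at_top. \<forall>j\<in>supp y. \<phi> (l0 x) - \<phi> 0 \<le> t * ?gap j"
    by (intro eventually_ball_finite) auto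
  then show ?thesis
    using eventually_ge_at_top[of 0]
  proof eventually_elim
    case (elim t)
    have scale: "capra N z (t *\<^sub>R y) = t * capra N z y" for z by (simp add: capra_def)
    have at_x: "capra N x y = dual_norm N y"
      using xy is_norm_pos[OF N \<open>x \<noteq> 0\<close>] \<open>x \<noteq> 0\<close> by (simp add: capra_def)
    have "t * capra N z y - \<phi> (l0 z) \<le> t * dual_norm N y - \<phi> (l0 x)" for z
    proof (cases "l0 x \<le> l0 z")
      case True
      then show ?thesis
        using mono'[OF True l0_le_CARD] mult_left_mono[OF capra_le_dual_norm[OF N, of z y] elim(2)]
        by simp
    next
      case False
      then have "\<not> supp y \<subseteq> supp z"
        using card_mono[of "supp z" "supp y"] supp by (auto simp: l0_def)
      then obtain j where j: "j \<in> supp y" "j \<notin> supp z" by blast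
      have "z \<bullet> coord_proj (- {j}) y = z \<bullet> y" using j(2) by (intro inner_coord_proj) auto
      then have "capra N z y = capra N z (coord_proj (- {j}) y)" by (simp add: capra_def)
      then have "capra N z y \<le> dual_norm N (coord_proj (- {j}) y)"
        using capra_le_dual_norm[OF N] by simp
      then have "t * capra N z y \<le> t * dual_norm N (coord_proj (- {j}) y)"
        using elim(2) by (rule mult_left_mono)
      moreover have "\<phi> 0 \<le> \<phi> (l0 z)" by (rule mono'[OF le0 l0_le_CARD])
      ultimately show ?thesis using elim(1) j(1) by (force simp: right_diff_distrib)
    qed
    then show ?case by (simp add: capra_subdifferential_iff scale at_x)
  qed
qed

theorem proposition7:
  fixes N :: "real ^ 'n \<Rightarrow> real" and \<phi> :: "nat \<Rightarrow> real"
  assumes "is_norm N"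
    and "orthant_strictly_monotonic N"
    and "orthant_strictly_monotonic (dual_norm N)"
    and "mono_on {0..CARD('n)} \<phi>"
  shows "(\<forall>x. capra_subdifferential N (\<lambda>z. ereal (\<phi> (l0 z))) x \<noteq> {}) \<and>
    (capra_subdifferential N (\<lambda>z. ereal (\<phi> (l0 z))) 0 =
        (\<Inter>j\<in>{1..CARD('n)}. (\<lambda>y. (\<phi> j - \<phi> 0) *\<^sub>R y) ` dual_coord_ball N j) \<and>
     (\<Inter>j\<in>{1..CARD('n)}. (\<lambda>y. (\<phi> j - \<phi> 0) *\<^sub>R y) ` dual_coord_ball N j) \<noteq> {}) \<and>
    (\<forall>x. x \<noteq> 0 \<longrightarrow>
        (\<exists>y. supp y = supp x \<and> x \<bullet> y = N x * dual_norm N y) \<and>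
        (\<forall>y. supp y = supp x \<and> x \<bullet> y = N x * dual_norm N y \<longrightarrow>
          (\<forall>\<^sub>F t in at_top. t *\<^sub>R y \<in> capra_subdifferential N (\<lambda>z. ereal (\<phi> (l0 z))) x)))"
proof -
  let ?D = "capra_subdifferential N (\<lambda>z. ereal (\<phi> (l0 z)))"
  let ?I = "\<Inter>j\<in>{1..CARD('n)}. (\<lambda>y. (\<phi> j - \<phi> 0) *\<^sub>R y) ` dual_coord_ball N j"
  note N = assms(1)
  have zero: "?D 0 = ?I" by (rule capra_subdifferential_l0_at_0[OF N assms(4)])
  have "0 \<in> ?D 0"
    unfolding capra_subdifferential_iff using mono_onD[OF assms(4), of 0] l0_le_CARD
    by (auto simp: capra_def)
  then have ne0: "?D 0 \<noteq> {}" by blast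
  have ex: "\<exists>y. supp y = supp x \<and> x \<bullet> y = N x * dual_norm N y" if "x \<noteq> 0" for x
    using ex_dual_vector_same_supp[OF assms(1-3) that] by metis
  have large: "\<forall>\<^sub>F t in at_top. t *\<^sub>R y \<in> ?D x"
    if "x \<noteq> 0" "supp y = supp x" "x \<bullet> y = N x * dual_norm N y" for x y
    using eventually_scaled_dual_vector_in_subdifferential[OF N assms(3,4) that] .
  have "?D x \<noteq> {}" for x
  proof (cases "x = 0")
    case True
    then show ?thesis using ne0 by simp
  next
    case False
    then obtain y where "\<forall>\<^sub>F t in at_top. t *\<^sub>R y \<in> ?D x" using ex large by blast
    then show ?thesis using eventually_happens'[OF trivial_limit_at_top_linorder] by blast
  qed
  with zero ne0 ex large show ?thesis by auto
qed

end
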